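(* Let $K=\mathbb{Q}(\sqrt2)$, $O_K=\mathbb{Z}[\sqrt2]$, and let $D_B$ be the quaternion algebra over $K$ with $K$-basis $1,i,j,ij$ and relations $i^2=-3$, $j^2=\sqrt2$, $ji=-ij$. The standard order $\operatorname{span}_{O_K}\{1,i,j,ij\}$ in $D_B$ is contained in precisely two maximal orders $\mathcal{Q}$ and $\mathcal{Q}'$ of $D_B$, and these two maximal orders are conjugate to each other.
   Context: An order in a quaternion algebra $A$ over a number field $k$ is a subring with unit that is a finitely generated $O_k$-module and whose ring of fractions is $A$ (orders are $O_k$-subalgebras). Two orders are conjugate if $\mathcal{Q}'=x\mathcal{Q}x^{-1}$ for some $x\in D_B^\times$. *)

theory Defs
  imports Complex_Main
begin

section \<open>The field \<open>K = \<rat>(\<surd>2)\<close> and the ring \<open>\<int>[\<surd>2]\<close>\<close>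

text \<open>\<open>QSqrt2 a b\<close> stands for \<open>a + b \<surd>2\<close>.\<close>

datatype qsqrt2 = QSqrt2 (rat_part: rat) (sqrt2_part: rat)

lemma qsqrt2_eq_iff: "x = y \<longleftrightarrow> rat_part x = rat_part y \<and> sqrt2_part x = sqrt2_part y"
  by (auto intro: qsqrt2.expand)

lemma qsqrt2_norm_eq_0:
  fixes a b :: rat
  assumes "a * a - 2 * (b * b) = 0"
  shows "a = 0 \<and> b = 0"
proof (rule ccontr)
  assume nz: "\<not> (a = 0 \<and> b = 0)"
  have b0: "b \<noteq> 0" using assms nz by auto
  define r where "r = a / b"
  have r: "r * r = 2" using assms b0 by (simp add: r_def field_simps)
  obtain m n where mn: "quotient_of r = (m, n)" by fastforce
  have n0: "n > 0" and cop: "coprime m n" and rq: "r = of_int m / of_int n"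
    using mn quotient_of_denom_pos quotient_of_coprime quotient_of_div by blast+
  have "(of_int (m * m) :: rat) = of_int (2 * (n * n))"
    using r n0 by (simp add: rq field_simps)
  hence eq: "m * m = 2 * (n * n)" by (simp only: of_int_eq_iff)
  hence "even (m * m)" by simp
  hence em: "even m" by simp
  then obtain k where k: "m = 2 * k" by blast
  have "n * n = 2 * (k * k)" using eq k by simp
  hence "even (n * n)" by simp
  hence "even n" by simp
  with em cop show False
    by (metis coprime_common_divisor not_is_unit_0 odd_one)
qed

instantiation qsqrt2 :: field
begin

definition "0 = QSqrt2 0 0"
definition "1 = QSqrt2 1 0"
definition "x + y = QSqrt2 (rat_part x + rat_part y) (sqrt2_part x + sqrt2_part y)"
definition "- x = QSqrt2 (- rat_part x) (- sqrt2_part x)"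
definition "x - y = QSqrt2 (rat_part x - rat_part y) (sqrt2_part x - sqrt2_part y)"
definition "x * y = QSqrt2
   (rat_part x * rat_part y + 2 * (sqrt2_part x * sqrt2_part y))
   (rat_part x * sqrt2_part y + sqrt2_part x * rat_part y)"
definition "inverse x =
   (let N = rat_part x * rat_part x - 2 * (sqrt2_part x * sqrt2_part x)
    in QSqrt2 (rat_part x / N) (- sqrt2_part x / N))"
definition "x div y = x * inverse (y :: qsqrt2)"

lemmas qsqrt2_defs = zero_qsqrt2_def one_qsqrt2_def plus_qsqrt2_def uminus_qsqrt2_def
  minus_qsqrt2_def times_qsqrt2_def

instance
proof
  fix x :: qsqrt2
  have aux: "a / N * a + 2 * (- b / N * b) = N / N" if "N = a * a - 2 * (b * b)" for a b N :: rat
    by (subst (3) that) (simp add: diff_divide_distrib)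
  define N where "N = rat_part x * rat_part x - 2 * (sqrt2_part x * sqrt2_part x)"
  assume "x \<noteq> 0"
  hence N0: "N \<noteq> 0"
    using qsqrt2_norm_eq_0[of "rat_part x" "sqrt2_part x", folded N_def]
    by (cases x) (auto simp: zero_qsqrt2_def)
  have inv: "inverse x = QSqrt2 (rat_part x / N) (- sqrt2_part x / N)"
    by (simp only: inverse_qsqrt2_def Let_def N_def)
  have "rat_part x / N * rat_part x + 2 * (- sqrt2_part x / N * sqrt2_part x) = N / N"
    by (rule aux[OF N_def])
  moreover have "rat_part x / N * sqrt2_part x + - sqrt2_part x / N * rat_part x = 0"
    by simp
  ultimately show "inverse x * x = 1"
    using N0 unfolding inv times_qsqrt2_def one_qsqrt2_def by simp
qed (auto simp: qsqrt2_defs inverse_qsqrt2_def divide_qsqrt2_def algebra_simps)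

end

definition sqrt2 :: qsqrt2 where
  "sqrt2 = QSqrt2 0 1"

definition OK :: "qsqrt2 set" where
  "OK = {of_int a + of_int b * sqrt2 | a b. True}"

lemma qsqrt2_simps [simp]:
  "rat_part 0 = 0" "sqrt2_part 0 = 0" "rat_part 1 = 1" "sqrt2_part 1 = 0"
  "rat_part (x + y) = rat_part x + rat_part y"
  "sqrt2_part (x + y) = sqrt2_part x + sqrt2_part y"
  "rat_part (- x) = - rat_part x" "sqrt2_part (- x) = - sqrt2_part x"
  "rat_part (x - y) = rat_part x - rat_part y"
  "sqrt2_part (x - y) = sqrt2_part x - sqrt2_part y"
  "rat_part (x * y) = rat_part x * rat_part y + 2 * (sqrt2_part x * sqrt2_part y)"
  "sqrt2_part (x * y) = rat_part x * sqrt2_part y + sqrt2_part x * rat_part y"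
  "rat_part sqrt2 = 0" "sqrt2_part sqrt2 = 1"
  by (simp_all add: qsqrt2_defs sqrt2_def)

lemma qsqrt2_of_nat [simp]: "rat_part (of_nat n) = of_nat n" "sqrt2_part (of_nat n) = 0"
  by (induction n) auto

lemma qsqrt2_of_int [simp]: "rat_part (of_int n) = of_int n" "sqrt2_part (of_int n) = 0"
  by (cases n; simp)+

lemma qsqrt2_numeral [simp]:
  "rat_part (numeral n) = numeral n" "sqrt2_part (numeral n) = 0"
  using qsqrt2_of_int[of "numeral n"] by simp_all

lemma sqrt2_squared: "sqrt2 * sqrt2 = 2"
  by (simp add: qsqrt2_eq_iff)

instance qsqrt2 :: field_char_0
proof
  show "inj (of_nat :: nat \<Rightarrow> qsqrt2)"
    by (rule injI) (simp add: qsqrt2_eq_iff)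
qed

lemma qsqrt2_of_rat [simp]: "rat_part (of_rat r) = r" "sqrt2_part (of_rat r) = 0"
proof -
  obtain m n where mn: "quotient_of r = (m, n)" by fastforce
  have n0: "n > 0" and rq: "r = of_int m / of_int n"
    using mn quotient_of_denom_pos quotient_of_div by blast+
  have "(of_rat r :: qsqrt2) * of_int n = of_int m"
    using n0 by (simp add: rq of_rat_divide)
  hence "rat_part (of_rat r :: qsqrt2) * of_int n = of_int m"
    "sqrt2_part (of_rat r :: qsqrt2) * of_int n = 0"
    by (simp_all add: qsqrt2_eq_iff)
  thus "rat_part (of_rat r) = r" "sqrt2_part (of_rat r) = 0"
    using n0 by (simp_all add: rq field_simps)
qed

lemma QSqrt2_eq: "QSqrt2 a b = of_rat a + of_rat b * sqrt2"
  by (simp add: qsqrt2_eq_iff)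

lemma OK_iff: "x \<in> OK \<longleftrightarrow> rat_part x \<in> \<int> \<and> sqrt2_part x \<in> \<int>"
  by (auto simp: OK_def qsqrt2_eq_iff elim!: Ints_cases)

lemma OK_closed [simp]:
  "0 \<in> OK" "1 \<in> OK" "sqrt2 \<in> OK" "numeral n \<in> OK"
  "x \<in> OK \<Longrightarrow> - x \<in> OK"
  "x \<in> OK \<Longrightarrow> y \<in> OK \<Longrightarrow> x + y \<in> OK"
  "x \<in> OK \<Longrightarrow> y \<in> OK \<Longrightarrow> x - y \<in> OK"
  "x \<in> OK \<Longrightarrow> y \<in> OK \<Longrightarrow> x * y \<in> OK"
  by (auto simp: OK_iff)


section \<open>The quaternion algebra \<open>D\<^sub>B\<close>\<close>

text \<open>\<open>DB a b c d\<close> stands for \<open>a + b i + c j + d ij\<close>. With \<open>ji = -ij\<close> one gets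
  \<open>(ij)\<^sup>2 = -i\<^sup>2j\<^sup>2\<close>, \<open>i(ij) = i\<^sup>2 j\<close>, \<open>(ij)i = -i\<^sup>2 j\<close>, \<open>j(ij) = -j\<^sup>2 i\<close>, \<open>(ij)j = j\<^sup>2 i\<close>;
  the multiplication below is this table for \<open>i\<^sup>2 = -3\<close>, \<open>j\<^sup>2 = \<surd>2\<close>.\<close>

datatype DB = DB (q1: qsqrt2) (qi: qsqrt2) (qj: qsqrt2) (qij: qsqrt2)

lemma DB_eq_iff: "x = y \<longleftrightarrow> q1 x = q1 y \<and> qi x = qi y \<and> qj x = qj y \<and> qij x = qij y"
  by (auto intro: DB.expand)

instantiation DB :: ring_1
begin

definition "0 = DB 0 0 0 0"
definition "1 = DB 1 0 0 0"
definition "x + y = DB (q1 x + q1 y) (qi x + qi y) (qj x + qj y) (qij x + qij y)"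
definition "- x = DB (- q1 x) (- qi x) (- qj x) (- qij x)"
definition "x - y = DB (q1 x - q1 y) (qi x - qi y) (qj x - qj y) (qij x - qij y)"
definition "x * y = DB
   (q1 x * q1 y - 3 * (qi x * qi y) + sqrt2 * (qj x * qj y) + 3 * sqrt2 * (qij x * qij y))
   (q1 x * qi y + qi x * q1 y - sqrt2 * (qj x * qij y) + sqrt2 * (qij x * qj y))
   (q1 x * qj y + qj x * q1 y - 3 * (qi x * qij y) + 3 * (qij x * qi y))
   (q1 x * qij y + qij x * q1 y + qi x * qj y - qj x * qi y)"

lemmas DB_defs = zero_DB_def one_DB_def plus_DB_def uminus_DB_def minus_DB_def times_DB_def

instance
  by standard (auto simp: DB_defs algebra_simps)

end

definition scaleK :: "qsqrt2 \<Rightarrow> DB \<Rightarrow> DB" where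
  "scaleK c x = DB (c * q1 x) (c * qi x) (c * qj x) (c * qij x)"

definition DB_i :: DB where "DB_i = DB 0 1 0 0"
definition DB_j :: DB where "DB_j = DB 0 0 1 0"

lemma DB_simps [simp]:
  "q1 0 = 0" "qi 0 = 0" "qj 0 = 0" "qij 0 = 0"
  "q1 1 = 1" "qi 1 = 0" "qj 1 = 0" "qij 1 = 0"
  "q1 (x + y) = q1 x + q1 y" "qi (x + y) = qi x + qi y"
  "qj (x + y) = qj x + qj y" "qij (x + y) = qij x + qij y"
  "q1 (- x) = - q1 x" "qi (- x) = - qi x" "qj (- x) = - qj x" "qij (- x) = - qij x"
  "q1 (x - y) = q1 x - q1 y" "qi (x - y) = qi x - qi y"
  "qj (x - y) = qj x - qj y" "qij (x - y) = qij x - qij y"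
  "q1 (scaleK c x) = c * q1 x" "qi (scaleK c x) = c * qi x"
  "qj (scaleK c x) = c * qj x" "qij (scaleK c x) = c * qij x"
  "q1 DB_i = 0" "qi DB_i = 1" "qj DB_i = 0" "qij DB_i = 0"
  "q1 DB_j = 0" "qi DB_j = 0" "qj DB_j = 1" "qij DB_j = 0"
  by (simp_all add: DB_defs scaleK_def DB_i_def DB_j_def)

lemma DB_mult_simps:
  "q1 (x * y) = q1 x * q1 y - 3 * (qi x * qi y) + sqrt2 * (qj x * qj y)
     + 3 * sqrt2 * (qij x * qij y)"
  "qi (x * y) = q1 x * qi y + qi x * q1 y - sqrt2 * (qj x * qij y) + sqrt2 * (qij x * qj y)"
  "qj (x * y) = q1 x * qj y + qj x * q1 y - 3 * (qi x * qij y) + 3 * (qij x * qi y)"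
  "qij (x * y) = q1 x * qij y + qij x * q1 y + qi x * qj y - qj x * qi y"
  by (simp_all add: times_DB_def)

lemma DB_relations:
  "DB_i * DB_i = scaleK (-3) 1"
  "DB_j * DB_j = scaleK sqrt2 1"
  "DB_j * DB_i = - (DB_i * DB_j)"
  by (simp_all add: DB_eq_iff DB_mult_simps)

lemma DB_basis:
  "DB a b c d = scaleK a 1 + scaleK b DB_i + scaleK c DB_j + scaleK d (DB_i * DB_j)"
  by (simp add: DB_eq_iff DB_mult_simps)

lemma scaleK_mult: "scaleK c x * y = scaleK c (x * y)" "x * scaleK c y = scaleK c (x * y)"
  by (simp_all add: DB_eq_iff DB_mult_simps algebra_simps)

interpretation DB: vector_space scaleK
  by standard (simp_all add: DB_eq_iff algebra_simps)


section \<open>Orders\<close>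

definition OK_span :: "DB set \<Rightarrow> DB set" where
  "OK_span S = {\<Sum>s\<in>T. scaleK (c s) s | T c. finite T \<and> T \<subseteq> S \<and> (\<forall>s\<in>T. c s \<in> OK)}"

definition finitely_generated_OK_module :: "DB set \<Rightarrow> bool" where
  "finitely_generated_OK_module Q \<longleftrightarrow> (\<exists>S. finite S \<and> Q = OK_span S)"

definition unital_subring :: "'a::ring_1 set \<Rightarrow> bool" where
  "unital_subring Q \<longleftrightarrow> 1 \<in> Q \<and> (\<forall>x\<in>Q. \<forall>y\<in>Q. x - y \<in> Q \<and> x * y \<in> Q)"

text \<open>The whole type is the (two-sided) classical ring of fractions of \<open>Q\<close>: the elements of
  \<open>Q\<close> that are not zero divisors in \<open>Q\<close> become invertible, and every element is both a right
  fraction \<open>a s\<^sup>-\<^sup>1\<close> and a left fraction \<open>s\<^sup>-\<^sup>1 a\<close> with \<open>a, s \<in> Q\<close>.\<close>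

definition regular_in :: "'a::ring_1 set \<Rightarrow> 'a \<Rightarrow> bool" where
  "regular_in Q s \<longleftrightarrow> s \<in> Q \<and> (\<forall>x\<in>Q. (s * x = 0 \<longrightarrow> x = 0) \<and> (x * s = 0 \<longrightarrow> x = 0))"

definition ring_of_fractions_is_UNIV :: "'a::ring_1 set \<Rightarrow> bool" where
  "ring_of_fractions_is_UNIV Q \<longleftrightarrow>
     (\<forall>s. regular_in Q s \<longrightarrow> (\<exists>t. s * t = 1 \<and> t * s = 1)) \<and>
     (\<forall>x. \<exists>a s t. a \<in> Q \<and> regular_in Q s \<and> s * t = 1 \<and> t * s = 1 \<and> x = a * t) \<and>
     (\<forall>x. \<exists>a s t. a \<in> Q \<and> regular_in Q s \<and> s * t = 1 \<and> t * s = 1 \<and> x = t * a)"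

text \<open>Closure under \<open>O\<^sub>K\<close>-scalars, i.e. being an \<open>O\<^sub>K\<close>-subalgebra, is part of \<open>Q\<close> being an
  \<open>O\<^sub>K\<close>-span.\<close>

definition is_order :: "DB set \<Rightarrow> bool" where
  "is_order Q \<longleftrightarrow>
     unital_subring Q \<and> finitely_generated_OK_module Q \<and> ring_of_fractions_is_UNIV Q"

definition is_maximal_order :: "DB set \<Rightarrow> bool" where
  "is_maximal_order Q \<longleftrightarrow> is_order Q \<and> (\<forall>Q'. is_order Q' \<and> Q \<subseteq> Q' \<longrightarrow> Q' = Q)"

definition conjugate_orders :: "DB set \<Rightarrow> DB set \<Rightarrow> bool" where
  "conjugate_orders Q Q' \<longleftrightarrow>
     (\<exists>x y. x * y = 1 \<and> y * x = 1 \<and> Q' = (\<lambda>q. x * q * y) ` Q)"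

definition standard_order :: "DB set" where
  "standard_order = OK_span {1, DB_i, DB_j, DB_i * DB_j}"

lemma standard_order_iff:
  "x \<in> standard_order \<longleftrightarrow> q1 x \<in> OK \<and> qi x \<in> OK \<and> qj x \<in> OK \<and> qij x \<in> OK"
proof
  define P where "P = (\<lambda>x. q1 x \<in> OK \<and> qi x \<in> OK \<and> qj x \<in> OK \<and> qij x \<in> OK)"
  assume "x \<in> standard_order"
  then obtain T c where T: "x = (\<Sum>s\<in>T. scaleK (c s) s)" "finite T"
      "T \<subseteq> {1, DB_i, DB_j, DB_i * DB_j}" "\<forall>s\<in>T. c s \<in> OK"
    by (auto simp: standard_order_def OK_span_def)
  have "P (\<Sum>s\<in>T. scaleK (c s) s)"
    using T(2-4)
  proof (induction T rule: finite_induct)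
    case empty
    then show ?case by (simp add: P_def)
  next
    case (insert s T)
    have s: "P s" using insert.prems(1) by (auto simp: P_def DB_mult_simps)
    then show ?case using insert by (simp add: P_def)
  qed
  with T(1) show "q1 x \<in> OK \<and> qi x \<in> OK \<and> qj x \<in> OK \<and> qij x \<in> OK"
    by (simp add: P_def)
next
  assume x: "q1 x \<in> OK \<and> qi x \<in> OK \<and> qj x \<in> OK \<and> qij x \<in> OK"
  define c where "c = (\<lambda>s. if s = 1 then q1 x else if s = DB_i then qi x
     else if s = DB_j then qj x else qij x)"
  have "x = (\<Sum>s\<in>{1, DB_i, DB_j, DB_i * DB_j}. scaleK (c s) s)"
    by (simp add: c_def DB_eq_iff DB_mult_simps)
  moreover have "\<forall>s. c s \<in> OK" using x by (simp add: c_def)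
  ultimately show "x \<in> standard_order"
    unfolding standard_order_def OK_span_def by blast
qed

lemma qsqrt2_times_int: "\<exists>n::int. n > 0 \<and> of_int n * x \<in> OK"
proof -
  obtain m n where mn: "quotient_of (rat_part x) = (m, n)" by fastforce
  obtain k l where kl: "quotient_of (sqrt2_part x) = (k, l)" by fastforce
  have n: "n > 0" "rat_part x = of_int m / of_int n"
    using mn quotient_of_denom_pos quotient_of_div by blast+
  have l: "l > 0" "sqrt2_part x = of_int k / of_int l"
    using kl quotient_of_denom_pos quotient_of_div by blast+
  have "rat_part (of_int (n * l) * x) = of_int (m * l)"
       "sqrt2_part (of_int (n * l) * x) = of_int (k * n)"
    using n l by (simp_all add: field_simps)
  hence "of_int (n * l) * x \<in> OK"
    unfolding OK_iff by (metis Ints_of_int)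
  thus ?thesis using n(1) l(1) by (intro exI[of _ "n * l"]) auto
qed

lemma DB_invertible:
  assumes "x \<noteq> (0::DB)"
  shows "\<exists>y. x * y = 1 \<and> y * x = 1"
proof -
  define N where "N = q1 x * q1 x + 3 * (qi x * qi x) - sqrt2 * (qj x * qj x)
    - 3 * sqrt2 * (qij x * qij x)"
  define e where "e = (\<lambda>z. real_of_rat (rat_part z) - real_of_rat (sqrt2_part z) * sqrt 2)"
  have e_mult: "e (a * b) = e a * e b" for a b
    by (simp add: e_def of_rat_add of_rat_mult algebra_simps)
  have e_add: "e (a + b) = e a + e b" "e (a - b) = e a - e b" for a b
    by (simp_all add: e_def of_rat_add of_rat_diff algebra_simps)
  have e3: "e 3 = 3" "e sqrt2 = - sqrt 2" "e 0 = 0"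
    by (simp_all add: e_def)
  have e0: "a = 0" if "e a = 0" for a
  proof -
    have "e a * (real_of_rat (rat_part a) + real_of_rat (sqrt2_part a) * sqrt 2)
       = real_of_rat (rat_part a * rat_part a - 2 * (sqrt2_part a * sqrt2_part a))"
      by (simp add: e_def of_rat_diff of_rat_mult algebra_simps)
    with that have "rat_part a * rat_part a - 2 * (sqrt2_part a * sqrt2_part a) = 0"
      by simp
    from qsqrt2_norm_eq_0[OF this] show ?thesis by (simp add: qsqrt2_eq_iff)
  qed
  have "N \<noteq> 0"
  proof
    assume "N = 0"
    hence "e N = 0" by (simp add: e3)
    hence eq: "e (q1 x) * e (q1 x) + 3 * (e (qi x) * e (qi x)) + sqrt 2 * (e (qj x) * e (qj x))
       + 3 * sqrt 2 * (e (qij x) * e (qij x)) = 0"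
      by (simp add: N_def e_mult e_add e3)
    have nn: "0 \<le> e (q1 x) * e (q1 x)" "0 \<le> 3 * (e (qi x) * e (qi x))"
      "0 \<le> sqrt 2 * (e (qj x) * e (qj x))" "0 \<le> 3 * sqrt 2 * (e (qij x) * e (qij x))"
      by simp_all
    have "e (q1 x) * e (q1 x) = 0" "3 * (e (qi x) * e (qi x)) = 0"
      "sqrt 2 * (e (qj x) * e (qj x)) = 0" "3 * sqrt 2 * (e (qij x) * e (qij x)) = 0"
      using eq nn by linarith+
    hence "x = 0" by (simp add: DB_eq_iff e0)
    with assms show False by simp
  qed
  define y where "y = scaleK (inverse N) (DB (q1 x) (- qi x) (- qj x) (- qij x))"
  have "x * y = scaleK (inverse N) (scaleK N 1)" "y * x = scaleK (inverse N) (scaleK N 1)"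
    unfolding y_def scaleK_mult by (rule arg_cong[of _ _ "scaleK (inverse N)"],
      simp add: DB_eq_iff DB_mult_simps N_def algebra_simps)+
  moreover have "scaleK (inverse N) (scaleK N 1) = 1"
    using \<open>N \<noteq> 0\<close> by (simp add: DB_eq_iff)
  ultimately show ?thesis by auto
qed

lemma is_order_standard_order: "is_order standard_order"
proof -
  have sub: "unital_subring standard_order"
    by (auto simp: unital_subring_def standard_order_iff DB_mult_simps)
  have fg: "finitely_generated_OK_module standard_order"
    unfolding finitely_generated_OK_module_def standard_order_def
    by (rule exI[of _ "{1, DB_i, DB_j, DB_i * DB_j}"]) simp
  have inv: "\<exists>t. s * t = 1 \<and> t * s = 1" if "regular_in standard_order s" for s
  proof -
    have "s \<noteq> 0" using that sub by (force simp: regular_in_def unital_subring_def)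
    thus ?thesis by (rule DB_invertible)
  qed
  have frac: "\<exists>a s t. a \<in> standard_order \<and> regular_in standard_order s \<and>
      s * t = 1 \<and> t * s = 1 \<and> x = a * t \<and> x = t * a" for x
  proof -
    obtain n1 where n1: "n1 > 0" "of_int n1 * q1 x \<in> OK" using qsqrt2_times_int by blast
    obtain n2 where n2: "n2 > 0" "of_int n2 * qi x \<in> OK" using qsqrt2_times_int by blast
    obtain n3 where n3: "n3 > 0" "of_int n3 * qj x \<in> OK" using qsqrt2_times_int by blast
    obtain n4 where n4: "n4 > 0" "of_int n4 * qij x \<in> OK" using qsqrt2_times_int by blast
    define n :: qsqrt2 where "n = of_int (n1 * n2 * n3 * n4)"
    have n0: "n \<noteq> 0" using n1 n2 n3 n4 by (simp add: n_def)
    have ints: "of_int k \<in> OK" for k by (simp add: OK_iff)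
    have nOK: "n \<in> OK" by (simp only: n_def ints)
    have eqs: "n * q1 x = of_int (n2 * n3 * n4) * (of_int n1 * q1 x)"
         "n * qi x = of_int (n1 * n3 * n4) * (of_int n2 * qi x)"
         "n * qj x = of_int (n1 * n2 * n4) * (of_int n3 * qj x)"
         "n * qij x = of_int (n1 * n2 * n3) * (of_int n4 * qij x)"
      by (simp_all add: n_def algebra_simps)
    have "n * q1 x \<in> OK" "n * qi x \<in> OK" "n * qj x \<in> OK" "n * qij x \<in> OK"
      unfolding eqs by (intro OK_closed(8) ints n1(2) n2(2) n3(2) n4(2))+
    hence a: "scaleK n x \<in> standard_order"
      by (simp add: standard_order_iff)
    have one: "scaleK n 1 * y = scaleK n y" "y * scaleK n 1 = scaleK n y" for y
      by (simp_all only: scaleK_mult mult_1_left mult_1_right)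
    have s: "regular_in standard_order (scaleK n 1)"
      unfolding regular_in_def one using n0 nOK by (auto simp: standard_order_iff)
    have inv1: "scaleK n 1 * scaleK (inverse n) 1 = 1" "scaleK (inverse n) 1 * scaleK n 1 = 1"
      unfolding one using n0 by (simp_all add: DB_eq_iff)
    have "x = scaleK n x * scaleK (inverse n) 1" "x = scaleK (inverse n) 1 * scaleK n x"
      unfolding scaleK_mult mult_1_left mult_1_right using n0 by simp_all
    with a s inv1 show ?thesis by blast
  qed
  show ?thesis
    unfolding is_order_def ring_of_fractions_is_UNIV_def
    by (intro conjI allI impI sub fg inv) (use frac in blast)+
qed

end

theory Submission
  imports Defs "HOL-Computational_Algebra.Primes"
begin

text \<open>Write \<open>\<zeta> = (1 + i)/2\<close>, a primitive sixth root of unity, \<open>L = K(i)\<close>, \<open>O\<^sub>L = O\<^sub>K[\<zeta>]\<close> and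
  \<open>u = 1 - \<surd>2\<close>. Two primes matter: the standard order has reduced discriminant
  \<open>4 \<cdot> 3 \<cdot> \<surd>2\<close>, up to units.

  At the prime \<open>\<surd>2\<close> the extension \<open>L/K\<close> is inert and \<open>j\<^sup>2 = \<surd>2\<close> is a uniformizer, so the algebra is
  ramified there and the elements of integral norm form the unique local maximal order, which is
  that of \<open>R = O\<^sub>L + O\<^sub>L j\<close>. The elementary form of this fact is a descent: if
  \<open>\<surd>2 x \<in> R\<close> and \<open>x\<close> has integral norm, then \<open>x \<in> R\<close> (\<open>eichler_order_descent\<close>), because the
  norm form \<open>p\<^sup>2 + pq + q\<^sup>2\<close> of \<open>O\<^sub>L\<close> is anisotropic modulo \<open>\<surd>2\<close>.

  At the prime \<open>3\<close>, \<open>\<surd>2\<close> is a square: \<open>u\<^sup>2 = \<surd>2 + 3u\<close>. Locally the algebra is a matrix algebra, and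
  \<open>R\<close> is an Eichler order of level \<open>3\<close>. It is an edge of the Bruhat-Tits tree, and its two ends are
  obtained by adjoining \<open>i(v + j)/3\<close> for \<open>v = u\<close> or \<open>v = -u\<close>. This element has norm
  \<open>(v\<^sup>2 - \<surd>2)/3 = u\<close>, so it is integral.

  An arbitrary order \<open>M\<close> containing the standard order has integral traces and norms
  (\<open>order_nrd_OK\<close>, \<open>order_trace_OK\<close>). Traces against \<open>1, i, j, ij\<close> give
  \<open>6\<surd>2 M \<subseteq> R\<close>, and the descent improves this to \<open>3M \<subseteq> R\<close>. For \<open>x = a + bi + cj + d ij\<close> in \<open>M\<close> the
  norm then says that \<open>3\<close> divides \<open>(6b)\<^sup>2 - u\<^sup>2 (6d)\<^sup>2\<close>; as \<open>3\<close> is prime in \<open>O\<^sub>K\<close>, it divides one of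
  \<open>6b \<mp> 6ud\<close>, which places \<open>x\<close> in one of the two overorders of \<open>R\<close>
  (\<open>order_subset_Un_overorders\<close>). A group is not the union of two proper subgroups, so all of \<open>M\<close>
  lies in one of them. Neither contains the other, hence both are maximal and there are no further
  maximal orders above the standard order. Finally, conjugation by \<open>i\<close> sends \<open>j\<close> to \<open>-j\<close> and
  therefore swaps them.\<close>

section \<open>Integrality in \<open>K\<close>\<close>

lemma rat_part_divide_numeral [simp]:
  "rat_part (x / numeral n) = rat_part x / numeral n"
  "sqrt2_part (x / numeral n) = sqrt2_part x / numeral n"
proof -
  define y where "y = x / numeral n"
  have "x = y * numeral n" by (simp add: y_def)
  thus "rat_part (x / numeral n) = rat_part x / numeral n"
    "sqrt2_part (x / numeral n) = sqrt2_part x / numeral n"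
    unfolding y_def[symmetric] by simp_all
qed

lemma OK_of_int [simp]: "of_int m \<in> OK"
  by (simp add: OK_iff)

text \<open>The norm from \<open>K\<close> down to \<open>\<rat>\<close>, as opposed to the reduced norm \<open>nrd\<close> from the quaternion
  algebra to \<open>K\<close>.\<close>

definition abs_norm :: "qsqrt2 \<Rightarrow> rat" where
  "abs_norm x = rat_part x * rat_part x - 2 * (sqrt2_part x * sqrt2_part x)"

lemma abs_norm_mult: "abs_norm (x * y) = abs_norm x * abs_norm y"
  by (simp add: abs_norm_def algebra_simps)

lemma abs_norm_power: "abs_norm (x ^ k) = abs_norm x ^ k"
  by (induction k) (simp_all add: abs_norm_mult, simp add: abs_norm_def)

lemma abs_norm_OK: "x \<in> OK \<Longrightarrow> abs_norm x \<in> \<int>"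
  by (simp add: OK_iff abs_norm_def)

text \<open>If \<open>r = a/n\<close> in lowest terms, every power of \<open>n\<close> divides \<open>m\<close>, which forces \<open>n = 1\<close>. Bounded
  denominators of powers replace the more usual monic polynomial as a witness of integrality.\<close>

lemma rat_bounded_powers_Ints:
  fixes r :: rat and m :: int
  assumes "m > 0" and int: "\<And>k. of_int m * r ^ k \<in> \<int>"
  shows "r \<in> \<int>"
proof -
  obtain a n where an: "quotient_of r = (a, n)" by fastforce
  have n: "n > 0" and cop: "coprime a n" and r: "r = of_int a / of_int n"
    using an quotient_of_denom_pos quotient_of_coprime quotient_of_div by blast+
  have dvd: "n ^ k dvd m" for k
  proof -
    obtain z where z: "of_int m * r ^ k = of_int z" using int[of k] by (auto elim: Ints_cases)
    have "(of_int (m * a ^ k) :: rat) = of_int (z * n ^ k)"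
      using z n by (simp add: r power_divide field_simps)
    hence "m * a ^ k = z * n ^ k" by (simp only: of_int_eq_iff)
    hence "n ^ k dvd m * a ^ k" by simp
    thus ?thesis
      using cop by (metis coprime_commute coprime_dvd_mult_left_iff coprime_power_left_iff coprime_power_right_iff)
  qed
  have "n = 1"
  proof (rule ccontr)
    assume "n \<noteq> 1"
    hence "n \<ge> 2" using n by simp
    hence "2 ^ nat m \<le> n ^ nat m" by (intro power_mono) auto
    also have "\<dots> \<le> m" using dvd[of "nat m"] \<open>m > 0\<close> by (rule zdvd_imp_le)
    finally have "2 ^ nat m \<le> m" .
    moreover have "int (nat m) < int (2 ^ nat m)" by (subst of_nat_less_iff) (rule less_exp)
    ultimately show False using \<open>m > 0\<close> by simp
  qed
  thus ?thesis by (simp add: r)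
qed

text \<open>The three norms determine \<open>2p\<close> and \<open>4q\<close> for \<open>x = p + q\<surd>2\<close> as integers; parity in
  \<open>p\<^sup>2 - 2q\<^sup>2 \<in> \<int>\<close> then removes the denominators.\<close>

lemma OK_if_conjugate_norms_Ints:
  assumes n: "abs_norm x \<in> \<int>" and n1: "abs_norm (1 + x) \<in> \<int>"
    and n2: "abs_norm (sqrt2 + x) \<in> \<int>"
  shows "x \<in> OK"
proof -
  have "2 * rat_part x = abs_norm (1 + x) - abs_norm x - 1"
    by (simp add: abs_norm_def algebra_simps)
  hence "2 * rat_part x \<in> \<int>" using n n1 by (metis Ints_1 Ints_diff)
  then obtain a where a: "2 * rat_part x = of_int a" by (auto elim: Ints_cases)
  have "4 * sqrt2_part x = abs_norm x - abs_norm (sqrt2 + x) - 2"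
    by (simp add: abs_norm_def algebra_simps)
  hence "4 * sqrt2_part x \<in> \<int>" using n n2 by (metis Ints_numeral Ints_diff)
  then obtain b where b: "4 * sqrt2_part x = of_int b" by (auto elim: Ints_cases)
  obtain c where c: "abs_norm x = of_int c" using n by (auto elim: Ints_cases)
  have ra: "rat_part x = of_int a / 2" and rb: "sqrt2_part x = of_int b / 4" using a b by auto
  have "(of_int (2 * (a * a) - b * b) :: rat) = of_int (8 * c)"
    using c by (simp add: abs_norm_def ra rb field_simps)
  hence eq: "2 * (a * a) - b * b = 8 * c" by (simp only: of_int_eq_iff)
  hence "b * b = 2 * (a * a - 4 * c)" by simp
  hence "even (b * b)" by simp
  then obtain b1 where b1: "b = 2 * b1" by (auto elim: evenE)
  with eq have eq1: "a * a = 2 * (b1 * b1 + 2 * c)" by simp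
  hence "even (a * a)" by simp
  then obtain a1 where a1: "a = 2 * a1" by (auto elim: evenE)
  with eq1 have "b1 * b1 = 2 * (a1 * a1 - c)" by simp
  hence "even (b1 * b1)" by simp
  then obtain b2 where "b1 = 2 * b2" by (auto elim: evenE)
  thus ?thesis by (simp add: OK_iff ra rb a1 b1)
qed

text \<open>\<open>O\<^sub>K\<close> is completely integrally closed. Shifting \<open>x\<close> by an integer keeps the denominators of the
  powers bounded, so the norms of \<open>x\<close>, \<open>1 + x\<close> and \<open>\<surd>2 + x\<close> are all rational integers.\<close>

lemma OK_bounded_powers:
  fixes m :: int
  assumes m: "m > 0" and bd: "\<And>k. of_int m * x ^ k \<in> OK"
  shows "x \<in> OK"
proof -
  have shift: "of_int m * ((c + x) ^ k * x ^ l) \<in> OK" if "c \<in> OK" for c k l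
  proof (induction k arbitrary: l)
    case 0
    show ?case using bd by simp
  next
    case (Suc k)
    have "of_int m * ((c + x) ^ Suc k * x ^ l)
        = c * (of_int m * ((c + x) ^ k * x ^ l)) + of_int m * ((c + x) ^ k * x ^ Suc l)"
      by (simp add: algebra_simps)
    thus ?case using Suc.IH[of l] Suc.IH[of "Suc l"] that by simp
  qed
  have norm: "abs_norm (c + x) \<in> \<int>" if "c \<in> OK" for c
  proof (rule rat_bounded_powers_Ints[of "m * m"])
    fix k
    have "of_int m * (c + x) ^ k \<in> OK" using shift[OF that, of k 0] by simp
    hence "abs_norm (of_int m * (c + x) ^ k) \<in> \<int>" by (rule abs_norm_OK)
    moreover have "abs_norm (of_int m) = of_int (m * m)" by (simp add: abs_norm_def)
    ultimately show "of_int (m * m) * abs_norm (c + x) ^ k \<in> \<int>"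
      by (simp add: abs_norm_mult abs_norm_power)
  qed (use m in simp)
  show ?thesis
    using norm[of 0] norm[of 1] norm[of sqrt2] by (intro OK_if_conjugate_norms_Ints) simp_all
qed

lemma three_dvd_sum_squares:
  fixes a b :: int
  assumes "3 dvd a * a - 2 * (b * b)"
  shows "3 dvd a \<and> 3 dvd b"
proof -
  have square_mod: "c * c mod 3 = (if 3 dvd c then 0 else 1)" for c :: int
  proof -
    define r where "r = c mod 3"
    have "c * c mod 3 = r * r mod 3" unfolding r_def by (rule mod_mult_eq[symmetric])
    moreover have "r \<in> {0, 1, 2}" by (auto simp: r_def)
    moreover have "3 dvd c \<longleftrightarrow> r = 0" by (simp add: r_def dvd_eq_mod_eq_0)
    ultimately show ?thesis by auto
  qed
  have "3 dvd a * a - 2 * (b * b) + 3 * (b * b)"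
    using assms by (intro dvd_add dvd_triv_left)
  moreover have "a * a - 2 * (b * b) + 3 * (b * b) = a * a + b * b" by simp
  ultimately have "(a * a + b * b) mod 3 = 0" by (simp only: dvd_eq_mod_eq_0)
  hence "(a * a mod 3 + b * b mod 3) mod 3 = 0" by (simp only: mod_add_eq)
  thus ?thesis by (simp add: square_mod split: if_splits)
qed

text \<open>\<open>3\<close> is inert in \<open>K\<close>: \<open>a\<^sup>2 - 2b\<^sup>2\<close> is \<open>a\<^sup>2 + b\<^sup>2\<close> modulo \<open>3\<close>, which is anisotropic, so divisibility
  by \<open>3\<close> can be read off the norm to \<open>\<rat>\<close>.\<close>

lemma three_prime_OK:
  assumes x: "x \<in> OK" and y: "y \<in> OK" and xy: "x * y / 3 \<in> OK"
  shows "x / 3 \<in> OK \<or> y / 3 \<in> OK"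
proof -
  have *: "z / 3 \<in> OK"
    if z: "z = of_int a + of_int b * sqrt2" and dvd: "3 dvd a * a - 2 * (b * b)" for z a b
  proof -
    obtain a' b' where "a = 3 * a'" "b = 3 * b'" using three_dvd_sum_squares[OF dvd] by (auto elim!: dvdE)
    thus ?thesis by (simp add: z OK_iff)
  qed
  obtain a b where ab: "x = of_int a + of_int b * sqrt2" using x by (auto simp: OK_def)
  obtain c d where cd: "y = of_int c + of_int d * sqrt2" using y by (auto simp: OK_def)
  obtain e f where ef: "x * y / 3 = of_int e + of_int f * sqrt2" using xy by (auto simp: OK_def)
  have n: "abs_norm (of_int a + of_int b * sqrt2) = of_int (a * a - 2 * (b * b))" for a b
    by (simp add: abs_norm_def)
  have n3: "abs_norm 3 = of_int 9" by (simp add: abs_norm_def)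
  have "x * y = 3 * (x * y / 3)" by simp
  hence "abs_norm x * abs_norm y = abs_norm 3 * abs_norm (x * y / 3)"
    by (metis abs_norm_mult)
  hence "(of_int ((a * a - 2 * (b * b)) * (c * c - 2 * (d * d))) :: rat)
      = of_int (9 * (e * e - 2 * (f * f)))"
    unfolding ef unfolding ab cd n n3 by simp
  hence "(a * a - 2 * (b * b)) * (c * c - 2 * (d * d)) = 9 * (e * e - 2 * (f * f))"
    by (simp only: of_int_eq_iff)
  hence "3 dvd (a * a - 2 * (b * b)) * (c * c - 2 * (d * d))" by simp
  moreover have "prime (3::int)" by simp
  ultimately have "3 dvd a * a - 2 * (b * b) \<or> 3 dvd c * c - 2 * (d * d)"
    by (simp add: prime_dvd_mult_iff)
  thus ?thesis using *[OF ab] *[OF cd] by blast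
qed

text \<open>The residue field at \<open>\<surd>2\<close> has two elements, and over it \<open>p\<^sup>2 + pq + q\<^sup>2\<close> vanishes only at the
  origin. This says that \<open>\<surd>2\<close> is inert in \<open>L\<close>.\<close>

lemma even_norm_form_sqrt2:
  assumes p: "p \<in> OK" and q: "q \<in> OK" and dv: "(p * p + p * q + q * q) / sqrt2 \<in> OK"
  shows "p / sqrt2 \<in> OK \<and> q / sqrt2 \<in> OK"
proof -
  have div_iff: "z / sqrt2 \<in> OK \<longleftrightarrow> even a" if "z = of_int a + of_int b * sqrt2" for z a b
  proof -
    have "z = QSqrt2 (of_int b) (of_int a / 2) * sqrt2"
      by (simp add: that qsqrt2_eq_iff)
    moreover have "sqrt2 \<noteq> 0" by (simp add: qsqrt2_eq_iff)
    ultimately have "z / sqrt2 = QSqrt2 (of_int b) (of_int a / 2)" by simp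
    moreover have "(of_int a / 2 :: rat) \<in> \<int> \<longleftrightarrow> even a"
    proof
      assume "(of_int a / 2 :: rat) \<in> \<int>"
      then obtain k where "(of_int a / 2 :: rat) = of_int k"
        by (rule Ints_cases)
      hence "(of_int a :: rat) = of_int (2 * k)" by simp
      hence "a = 2 * k" by (simp only: of_int_eq_iff)
      thus "even a" by simp
    qed (auto elim: evenE)
    ultimately show ?thesis by (simp add: OK_iff)
  qed
  obtain a b where ab: "p = of_int a + of_int b * sqrt2" using p by (auto simp: OK_def)
  obtain c d where cd: "q = of_int c + of_int d * sqrt2" using q by (auto simp: OK_def)
  have "p * p + p * q + q * q = of_int (a * a + a * c + c * c + 2 * (b * b + b * d + d * d))
      + of_int (2 * a * b + a * d + b * c + 2 * c * d) * sqrt2"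
    by (simp add: ab cd qsqrt2_eq_iff algebra_simps)
  from div_iff[OF this] dv have "even (a * a + a * c + c * c)" by simp
  hence "even a \<and> even c" by auto
  thus ?thesis using div_iff[OF ab] div_iff[OF cd] by blast
qed


section \<open>Spans over \<open>O\<^sub>K\<close>\<close>

lemma OK_span_zero: "0 \<in> OK_span S"
  unfolding OK_span_def by (rule CollectI, rule exI[of _ "{}"]) auto

lemma OK_span_base: "s \<in> S \<Longrightarrow> s \<in> OK_span S"
  unfolding OK_span_def by (rule CollectI, rule exI[of _ "{s}"], rule exI[of _ "\<lambda>_. 1"]) auto

lemma OK_span_add:
  assumes "x \<in> OK_span S" "y \<in> OK_span S"
  shows "x + y \<in> OK_span S"
proof -
  obtain T c where T: "x = (\<Sum>s\<in>T. scaleK (c s) s)" "finite T" "T \<subseteq> S" "\<forall>s\<in>T. c s \<in> OK"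
    using assms(1) by (auto simp: OK_span_def)
  obtain U d where U: "y = (\<Sum>s\<in>U. scaleK (d s) s)" "finite U" "U \<subseteq> S" "\<forall>s\<in>U. d s \<in> OK"
    using assms(2) by (auto simp: OK_span_def)
  \<comment> \<open>Both combinations are extended by zero to the common support \<open>T \<union> U\<close>.\<close>
  define c' where "c' s = (if s \<in> T then c s else 0)" for s
  define d' where "d' s = (if s \<in> U then d s else 0)" for s
  have "x = (\<Sum>s\<in>T \<union> U. scaleK (c' s) s)"
    unfolding T(1) using T(2) U(2) by (intro sum.mono_neutral_cong_left) (auto simp: c'_def)
  moreover have "y = (\<Sum>s\<in>T \<union> U. scaleK (d' s) s)"
    unfolding U(1) using T(2) U(2) by (intro sum.mono_neutral_cong_left) (auto simp: d'_def)
  ultimately have "x + y = (\<Sum>s\<in>T \<union> U. scaleK (c' s + d' s) s)"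
    by (simp add: sum.distrib DB.scale_left_distrib)
  moreover have "\<forall>s\<in>T \<union> U. c' s + d' s \<in> OK"
    using T(4) U(4) by (auto simp: c'_def d'_def)
  ultimately show ?thesis
    using T(2,3) U(2,3) unfolding OK_span_def
    by (intro CollectI exI[of _ "T \<union> U"] exI[of _ "\<lambda>s. c' s + d' s"]) auto
qed

lemma OK_span_scale:
  assumes "x \<in> OK_span S" "r \<in> OK"
  shows "scaleK r x \<in> OK_span S"
proof -
  obtain T c where T: "x = (\<Sum>s\<in>T. scaleK (c s) s)" "finite T" "T \<subseteq> S" "\<forall>s\<in>T. c s \<in> OK"
    using assms(1) by (auto simp: OK_span_def)
  have "scaleK r x = (\<Sum>s\<in>T. scaleK (r * c s) s)"
    by (simp add: T(1) DB.scale_sum_right)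
  thus ?thesis
    using T(2-4) assms(2) unfolding OK_span_def
    by (intro CollectI exI[of _ T] exI[of _ "\<lambda>s. r * c s"]) auto
qed

lemma OK_span_induct [consumes 1, case_names zero step]:
  assumes x: "x \<in> OK_span S"
    and zero: "P 0"
    and step: "\<And>c s y. c \<in> OK \<Longrightarrow> s \<in> S \<Longrightarrow> P y \<Longrightarrow> P (scaleK c s + y)"
  shows "P x"
proof -
  obtain T c where T: "x = (\<Sum>s\<in>T. scaleK (c s) s)" "finite T" "T \<subseteq> S" "\<forall>s\<in>T. c s \<in> OK"
    using x by (auto simp: OK_span_def)
  from T(2-4) have "P (\<Sum>s\<in>T. scaleK (c s) s)"
  proof (induction T rule: finite_induct)
    case (insert s T)
    thus ?case using step[of "c s" s] by simp
  qed (simp add: zero)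
  thus ?thesis by (simp add: T(1))
qed

lemma OK_span_mult:
  assumes gens: "\<And>s t. s \<in> S \<Longrightarrow> t \<in> S \<Longrightarrow> s * t \<in> OK_span S"
    and x: "x \<in> OK_span S" and y: "y \<in> OK_span S"
  shows "x * y \<in> OK_span S"
  using x
proof (induction rule: OK_span_induct)
  case zero
  show ?case by (simp add: OK_span_zero)
next
  case (step c s x)
  from y have "s * y \<in> OK_span S"
  proof (induction rule: OK_span_induct)
    case zero
    show ?case by (simp add: OK_span_zero)
  next
    case (step d t y)
    thus ?case
      using gens[OF \<open>s \<in> S\<close>]
      by (simp add: distrib_left scaleK_mult OK_span_add OK_span_scale)
  qed
  with step show ?case
    by (simp add: distrib_right scaleK_mult OK_span_add OK_span_scale)
qed

lemma unital_subring_OK_span: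
  assumes "1 \<in> S" and "\<And>s t. s \<in> S \<Longrightarrow> t \<in> S \<Longrightarrow> s * t \<in> OK_span S"
  shows "unital_subring (OK_span S)"
proof -
  have "x - y \<in> OK_span S" if "x \<in> OK_span S" "y \<in> OK_span S" for x y
    using OK_span_add[OF that(1) OK_span_scale[OF that(2), of "- 1"]] by simp
  thus ?thesis
    using assms by (simp add: unital_subring_def OK_span_base OK_span_mult)
qed


section \<open>Orders have integral norms and traces\<close>

lemma unital_subring_closed:
  assumes "unital_subring Q"
  shows "1 \<in> Q" "0 \<in> Q"
    and "x \<in> Q \<Longrightarrow> y \<in> Q \<Longrightarrow> x - y \<in> Q"
    and "x \<in> Q \<Longrightarrow> y \<in> Q \<Longrightarrow> x + y \<in> Q"
    and "x \<in> Q \<Longrightarrow> y \<in> Q \<Longrightarrow> x * y \<in> Q"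
    and "x \<in> Q \<Longrightarrow> x ^ k \<in> Q"
proof -
  have *: "1 \<in> Q" "\<And>x y. x \<in> Q \<Longrightarrow> y \<in> Q \<Longrightarrow> x - y \<in> Q"
    "\<And>x y. x \<in> Q \<Longrightarrow> y \<in> Q \<Longrightarrow> x * y \<in> Q"
    using assms by (simp_all add: unital_subring_def)
  have zero: "0 \<in> Q" using *(2)[OF *(1) *(1)] by simp
  have "x + y = x - (0 - y)" by simp
  thus "1 \<in> Q" "0 \<in> Q" "x \<in> Q \<Longrightarrow> y \<in> Q \<Longrightarrow> x - y \<in> Q"
    "x \<in> Q \<Longrightarrow> y \<in> Q \<Longrightarrow> x + y \<in> Q" "x \<in> Q \<Longrightarrow> y \<in> Q \<Longrightarrow> x * y \<in> Q"
    using * zero by metis+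
  show "x \<in> Q \<Longrightarrow> x ^ k \<in> Q" by (induction k) (simp_all add: *)
qed

text \<open>The reduced norm. It is negative on the \<open>j\<close> and \<open>ij\<close> coordinates because \<open>j\<^sup>2 = \<surd>2\<close> and
  \<open>(ij)\<^sup>2 = 3\<surd>2\<close>.\<close>

definition nrd :: "DB \<Rightarrow> qsqrt2" where
  "nrd x = q1 x * q1 x + 3 * (qi x * qi x) - sqrt2 * (qj x * qj x)
     - 3 * sqrt2 * (qij x * qij x)"

lemma nrd_one: "nrd 1 = 1"
  by (simp add: nrd_def)

definition quat_conj :: "DB \<Rightarrow> DB" where
  "quat_conj x = DB (q1 x) (- qi x) (- qj x) (- qij x)"

lemma quat_conj_mult: "quat_conj (x * y) = quat_conj y * quat_conj x"
  by (simp add: DB_eq_iff DB_mult_simps quat_conj_def algebra_simps)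

lemma mult_quat_conj: "x * quat_conj x = scaleK (nrd x) 1"
  by (simp add: DB_eq_iff DB_mult_simps quat_conj_def nrd_def algebra_simps)

lemma nrd_mult: "nrd (x * y) = nrd x * nrd y"
proof -
  have "scaleK (nrd (x * y)) 1 = x * (y * quat_conj y) * quat_conj x"
    by (simp only: mult_quat_conj[symmetric] quat_conj_mult mult.assoc)
  also have "\<dots> = scaleK (nrd y) (x * quat_conj x)"
    by (simp only: mult_quat_conj scaleK_mult mult_1_right)
  also have "\<dots> = scaleK (nrd x * nrd y) 1"
    by (simp add: mult_quat_conj mult.commute)
  finally show ?thesis by (simp add: DB_eq_iff)
qed

lemma nrd_power: "nrd (x ^ k) = nrd x ^ k"
  by (induction k) (simp_all add: nrd_one nrd_mult)

lemma nrd_scale: "nrd (scaleK c x) = c * c * nrd x"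
  by (simp add: nrd_def algebra_simps)

lemma nrd_standard_order: "x \<in> standard_order \<Longrightarrow> nrd x \<in> OK"
  by (simp add: nrd_def standard_order_iff)

lemma standard_order_scale: "x \<in> standard_order \<Longrightarrow> c \<in> OK \<Longrightarrow> scaleK c x \<in> standard_order"
  by (simp add: standard_order_iff)

lemma standard_order_common_multiple:
  "\<exists>m::int. m > 0 \<and> scaleK (of_int m) x \<in> standard_order"
proof -
  obtain a where a: "a > 0" "of_int a * q1 x \<in> OK" using qsqrt2_times_int by blast
  obtain b where b: "b > 0" "of_int b * qi x \<in> OK" using qsqrt2_times_int by blast
  obtain c where c: "c > 0" "of_int c * qj x \<in> OK" using qsqrt2_times_int by blast
  obtain d where d: "d > 0" "of_int d * qij x \<in> OK" using qsqrt2_times_int by blast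
  have "of_int (b * c * d) * (of_int a * q1 x) \<in> OK" "of_int (a * c * d) * (of_int b * qi x) \<in> OK"
    "of_int (a * b * d) * (of_int c * qj x) \<in> OK" "of_int (a * b * c) * (of_int d * qij x) \<in> OK"
    by (intro OK_closed(8) OK_of_int a b c d)+
  hence "scaleK (of_int (a * b * c * d)) x \<in> standard_order"
    by (simp add: standard_order_iff mult_ac)
  thus ?thesis using a b c d by (intro exI[of _ "a * b * c * d"]) simp
qed

lemma OK_span_common_denominator:
  assumes "finite S"
  shows "\<exists>m::int. m > 0 \<and> (\<forall>x\<in>OK_span S. scaleK (of_int m) x \<in> standard_order)"
proof -
  from assms have "\<exists>m::int. m > 0 \<and> (\<forall>s\<in>S. scaleK (of_int m) s \<in> standard_order)"
  proof (induction S rule: finite_induct)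
    case empty
    show ?case by (rule exI[of _ 1]) simp
  next
    case (insert s S)
    then obtain m :: int where m: "m > 0" "\<forall>s\<in>S. scaleK (of_int m) s \<in> standard_order" by blast
    obtain n :: int where n: "n > 0" "scaleK (of_int n) s \<in> standard_order"
      using standard_order_common_multiple by blast
    have "scaleK (of_int (m * n)) t \<in> standard_order" if "t \<in> insert s S" for t
    proof (cases "t = s")
      case True
      have "scaleK (of_int (m * n)) t = scaleK (of_int m) (scaleK (of_int n) s)" by (simp add: True)
      thus ?thesis using n(2) by (simp only: standard_order_scale OK_of_int)
    next
      case False
      have "scaleK (of_int (m * n)) t = scaleK (of_int n) (scaleK (of_int m) t)"
        by (simp add: mult.commute)
      moreover have "scaleK (of_int m) t \<in> standard_order" using that False m(2) by blast
      ultimately show ?thesis by (simp only: standard_order_scale OK_of_int)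
    qed
    thus ?case using m(1) n(1) by (intro exI[of _ "m * n"]) simp
  qed
  then obtain m :: int where m: "m > 0" "\<forall>s\<in>S. scaleK (of_int m) s \<in> standard_order" by blast
  have "scaleK (of_int m) x \<in> standard_order" if "x \<in> OK_span S" for x
    using that
  proof (induction rule: OK_span_induct)
    case zero
    show ?case by (simp add: standard_order_iff)
  next
    case (step c s y)
    have "scaleK (of_int m) (scaleK c s + y) = scaleK c (scaleK (of_int m) s) + scaleK (of_int m) y"
      by (simp add: DB.scale_right_distrib mult.commute)
    moreover have "scaleK c (scaleK (of_int m) s) \<in> standard_order"
      using step(1,2) m(2) by (blast intro: standard_order_scale)
    ultimately show ?case using step by (simp add: standard_order_iff)
  qed
  with m(1) show ?thesis by blast
qed

text \<open>A finitely generated module has a common denominator \<open>m\<close> with respect to the standard order. Since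
  \<open>M\<close> contains all powers of \<open>x\<close>, the single number \<open>m\<^sup>2\<close> clears the denominators of all powers of
  the norm of \<open>x\<close>.\<close>

lemma order_nrd_OK:
  assumes M: "is_order M" and x: "x \<in> M"
  shows "nrd x \<in> OK"
proof -
  have ring: "unital_subring M" using M by (simp add: is_order_def)
  obtain S where "finite S" "M = OK_span S"
    using M by (auto simp: is_order_def finitely_generated_OK_module_def)
  then obtain m :: int where m: "m > 0" "\<And>y. y \<in> M \<Longrightarrow> scaleK (of_int m) y \<in> standard_order"
    using OK_span_common_denominator by blast
  show ?thesis
  proof (rule OK_bounded_powers)
    show "m * m > 0" using m(1) by simp
    fix k
    have "x ^ k \<in> M" using unital_subring_closed(6)[OF ring x] .
    hence "nrd (scaleK (of_int m) (x ^ k)) \<in> OK" by (intro nrd_standard_order m(2))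
    thus "of_int (m * m) * nrd x ^ k \<in> OK" by (simp add: nrd_scale nrd_power)
  qed
qed

text \<open>Polarizing the norm with \<open>1\<close> yields the trace \<open>2a\<close> of \<open>x = a + bi + cj + d ij\<close>.\<close>

lemma order_trace_OK:
  assumes M: "is_order M" and x: "x \<in> M"
  shows "2 * q1 x \<in> OK"
proof -
  have ring: "unital_subring M" using M by (simp add: is_order_def)
  have "1 + x \<in> M" using unital_subring_closed[OF ring] x by blast
  moreover have "2 * q1 x = nrd (1 + x) - nrd x - 1" by (simp add: nrd_def algebra_simps)
  ultimately show ?thesis using order_nrd_OK[OF M] x by simp
qed


section \<open>The Eichler order \<open>O\<^sub>L + O\<^sub>L j\<close>\<close>

definition zeta6 :: DB where "zeta6 = DB (1/2) (1/2) 0 0"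

text \<open>\<open>O\<^sub>L + O\<^sub>L j\<close>, given by integrality of the four coordinates with respect to the basis
  \<open>1, \<zeta>, j, \<zeta>j\<close>.\<close>

definition eichler_order :: "DB set" where
  "eichler_order = {x. q1 x - qi x \<in> OK \<and> 2 * qi x \<in> OK \<and> qj x - qij x \<in> OK \<and> 2 * qij x \<in> OK}"

text \<open>In the basis \<open>1, \<zeta>, j, \<zeta>j\<close> the norm is \<open>N\<^sub>1 - \<surd>2 N\<^sub>2\<close>, where \<open>N\<^sub>1\<close> and \<open>N\<^sub>2\<close> are two copies of the
  norm form of \<open>O\<^sub>L\<close>.\<close>

lemma nrd_eichler_coordinates:
  "nrd x = (q1 x - qi x) * (q1 x - qi x) + (q1 x - qi x) * (2 * qi x) + (2 * qi x) * (2 * qi x)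
     - sqrt2 * ((qj x - qij x) * (qj x - qij x) + (qj x - qij x) * (2 * qij x)
         + (2 * qij x) * (2 * qij x))"
proof -
  have form: "b * b + b * (2 * c) + (2 * c) * (2 * c) = (b + c) * (b + c) + 3 * (c * c)"
    for b c :: qsqrt2 by (simp add: algebra_simps)
  show ?thesis unfolding form by (simp add: nrd_def distrib_left)
qed

text \<open>Let \<open>p, q, r, s\<close> be the coordinates of \<open>\<surd>2 x\<close>. As \<open>2\<close> divides
  \<open>(p\<^sup>2 + pq + q\<^sup>2) - \<surd>2 (r\<^sup>2 + rs + s\<^sup>2)\<close>, first \<open>\<surd>2\<close> divides \<open>p\<close> and \<open>q\<close>; then \<open>2\<close> divides the first
  bracket, so \<open>\<surd>2\<close> divides the second and hence \<open>r\<close> and \<open>s\<close>. In the proof the letters denote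
  the coordinates of \<open>x\<close> itself.\<close>

lemma eichler_order_descent:
  assumes x: "scaleK sqrt2 x \<in> eichler_order" and n: "nrd x \<in> OK"
  shows "x \<in> eichler_order"
proof -
  define p q r s where "p = q1 x - qi x" and "q = 2 * qi x" and "r = qj x - qij x" and "s = 2 * qij x"
  have s0: "sqrt2 \<noteq> 0" by (simp add: qsqrt2_eq_iff)
  have OK: "sqrt2 * p \<in> OK" "sqrt2 * q \<in> OK" "sqrt2 * r \<in> OK" "sqrt2 * s \<in> OK"
    using x by (simp_all add: eichler_order_def p_def q_def r_def s_def algebra_simps)
  have nrd: "nrd x = p * p + p * q + q * q - sqrt2 * (r * r + r * s + s * s)"
    unfolding p_def q_def r_def s_def by (rule nrd_eichler_coordinates)
  have "((sqrt2 * p) * (sqrt2 * p) + (sqrt2 * p) * (sqrt2 * q) + (sqrt2 * q) * (sqrt2 * q)) / sqrt2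
      = sqrt2 * nrd x + ((sqrt2 * r) * (sqrt2 * r) + (sqrt2 * r) * (sqrt2 * s) + (sqrt2 * s) * (sqrt2 * s))"
    using s0 by (simp add: nrd field_simps)
  also have "\<dots> \<in> OK" using n OK by simp
  finally have pq: "p \<in> OK" "q \<in> OK"
    using even_norm_form_sqrt2[OF OK(1,2)] s0 by simp_all
  have "((sqrt2 * r) * (sqrt2 * r) + (sqrt2 * r) * (sqrt2 * s) + (sqrt2 * s) * (sqrt2 * s)) / sqrt2
      = p * p + p * q + q * q - nrd x"
    using s0 by (simp add: nrd field_simps)
  also have "\<dots> \<in> OK" using n pq by simp
  finally have "r \<in> OK" "s \<in> OK"
    using even_norm_form_sqrt2[OF OK(3,4)] s0 by simp_all
  with pq show ?thesis by (simp add: eichler_order_def p_def q_def r_def s_def)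
qed


section \<open>The two overorders of the Eichler order\<close>

text \<open>The element \<open>i(v + j)/3\<close>. For \<open>v = \<plusminus>(1 - \<surd>2)\<close> one has \<open>v\<^sup>2 \<equiv> \<surd>2\<close> modulo \<open>3\<close>, which makes its norm
  \<open>(v\<^sup>2 - \<surd>2)/3\<close> integral.\<close>

definition glue :: "qsqrt2 \<Rightarrow> DB" where "glue v = DB 0 (v / 3) 0 (1 / 3)"

text \<open>The module \<open>R + O\<^sub>K i(v + j)/3\<close> is defined for all \<open>v\<close>, but it is a ring only for suitable \<open>v\<close>.\<close>

definition overorder :: "qsqrt2 \<Rightarrow> DB set" where
  "overorder v = {x. \<exists>t\<in>OK. x - scaleK t (glue v) \<in> eichler_order}"

lemma overorderI: "t \<in> OK \<Longrightarrow> x - scaleK t (glue v) \<in> eichler_order \<Longrightarrow> x \<in> overorder v"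
  by (auto simp: overorder_def)

lemma eichler_order_module:
  "0 \<in> eichler_order"
  "x \<in> eichler_order \<Longrightarrow> y \<in> eichler_order \<Longrightarrow> x + y \<in> eichler_order"
  "x \<in> eichler_order \<Longrightarrow> c \<in> OK \<Longrightarrow> scaleK c x \<in> eichler_order"
proof -
  show "0 \<in> eichler_order" by (simp add: eichler_order_def)
  have "q1 (x + y) - qi (x + y) = (q1 x - qi x) + (q1 y - qi y)"
    "qj (x + y) - qij (x + y) = (qj x - qij x) + (qj y - qij y)"
    "2 * qi (x + y) = 2 * qi x + 2 * qi y" "2 * qij (x + y) = 2 * qij x + 2 * qij y"
    by (simp_all add: algebra_simps)
  thus "x \<in> eichler_order \<Longrightarrow> y \<in> eichler_order \<Longrightarrow> x + y \<in> eichler_order"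
    unfolding eichler_order_def mem_Collect_eq by (metis OK_closed(6))
  have "q1 (scaleK c x) - qi (scaleK c x) = c * (q1 x - qi x)"
    "qj (scaleK c x) - qij (scaleK c x) = c * (qj x - qij x)"
    "2 * qi (scaleK c x) = c * (2 * qi x)" "2 * qij (scaleK c x) = c * (2 * qij x)"
    by (simp_all add: algebra_simps)
  thus "x \<in> eichler_order \<Longrightarrow> c \<in> OK \<Longrightarrow> scaleK c x \<in> eichler_order"
    unfolding eichler_order_def mem_Collect_eq by (metis OK_closed(8))
qed

lemma standard_subset_eichler: "standard_order \<subseteq> eichler_order"
  by (auto simp: standard_order_iff eichler_order_def)

lemma eichler_subset_overorder: "eichler_order \<subseteq> overorder v"
  by (auto intro!: overorderI[of 0])

text \<open>The generators make the module finitely generated and reduce closure under multiplication to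
  finitely many products.\<close>

lemma overorder_eq_span:
  "overorder v = OK_span {1, zeta6, DB_j, zeta6 * DB_j, glue v}" (is "_ = OK_span ?S")
proof
  show "overorder v \<subseteq> OK_span ?S"
  proof
    fix x assume "x \<in> overorder v"
    then obtain t where t: "t \<in> OK" "x - scaleK t (glue v) \<in> eichler_order"
      by (auto simp: overorder_def)
    define y where "y = x - scaleK t (glue v)"
    have "y = scaleK (q1 y - qi y) 1 + scaleK (2 * qi y) zeta6 + scaleK (qj y - qij y) DB_j
        + scaleK (2 * qij y) (zeta6 * DB_j)"
      by (simp add: DB_eq_iff DB_mult_simps zeta6_def)
    hence x: "x = scaleK (q1 y - qi y) 1 + scaleK (2 * qi y) zeta6 + scaleK (qj y - qij y) DB_j
        + scaleK (2 * qij y) (zeta6 * DB_j) + scaleK t (glue v)"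
      unfolding y_def by (simp add: algebra_simps)
    have "q1 y - qi y \<in> OK" "2 * qi y \<in> OK" "qj y - qij y \<in> OK" "2 * qij y \<in> OK"
      using t(2) by (simp_all only: y_def eichler_order_def mem_Collect_eq)
    with t(1) show "x \<in> OK_span ?S"
      by (subst x) (intro OK_span_add OK_span_scale OK_span_base; simp)
  qed
  show "OK_span ?S \<subseteq> overorder v"
  proof
    fix x assume "x \<in> OK_span ?S"
    thus "x \<in> overorder v"
    proof (induction rule: OK_span_induct)
      case zero
      show ?case using eichler_order_module(1) eichler_subset_overorder by blast
    next
      case (step c s y)
      then obtain t where t: "t \<in> OK" "y - scaleK t (glue v) \<in> eichler_order"
        by (auto simp: overorder_def)
      have "1 \<in> eichler_order" "zeta6 \<in> eichler_order" "DB_j \<in> eichler_order"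
        "zeta6 * DB_j \<in> eichler_order"
        by (simp_all add: eichler_order_def zeta6_def DB_mult_simps)
      hence "s \<in> eichler_order \<or> s = glue v" using step(2) by blast
      thus ?case
      proof
        assume "s \<in> eichler_order"
        hence "scaleK c s + (y - scaleK t (glue v)) \<in> eichler_order"
          using t(2) step(1) by (intro eichler_order_module)
        thus ?thesis by (intro overorderI[OF t(1)]) (simp add: algebra_simps)
      next
        assume "s = glue v"
        thus ?thesis
          using t step(1) by (intro overorderI[of "c + t"]) (simp_all add: algebra_simps)
      qed
    qed
  qed
qed

text \<open>Writing the scalars as pairs of rational coordinates turns each membership in the next
  multiplication table into arithmetic of rational numbers.\<close>

lemma zeta6_eq: "zeta6 = DB (QSqrt2 (1/2) 0) (QSqrt2 (1/2) 0) 0 0"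
  by (simp add: zeta6_def DB_eq_iff qsqrt2_eq_iff)

lemma glue_eq:
  "glue (1 - sqrt2) = DB 0 (QSqrt2 (1/3) (- 1/3)) 0 (QSqrt2 (1/3) 0)"
  "glue (sqrt2 - 1) = DB 0 (QSqrt2 (- 1/3) (1/3)) 0 (QSqrt2 (1/3) 0)"
  by (simp_all add: glue_def DB_eq_iff qsqrt2_eq_iff)

text \<open>Every product of generators lies in \<open>R\<close> after a suitable integral multiple of \<open>g = i(v + j)/3\<close> is
  subtracted. The multiples come from \<open>\<zeta> \<equiv> 2\<close> modulo \<open>i O\<^sub>L\<close>, whence \<open>\<zeta>g \<equiv> 2g\<close>, and from
  \<open>jg = -vg + (v\<^sup>2 - \<surd>2) i/3\<close>; the products in the opposite order follow by quaternion
  conjugation, which negates \<open>g\<close>, \<open>j\<close> and \<open>\<zeta>j\<close>.\<close>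

lemma overorder_generators_mult:
  assumes v: "v \<in> {1 - sqrt2, sqrt2 - 1}"
    and s: "s \<in> {1, zeta6, DB_j, zeta6 * DB_j, glue v}"
    and t: "t \<in> {1, zeta6, DB_j, zeta6 * DB_j, glue v}"
  shows "s * t \<in> overorder v"
proof -
  let ?S = "{1, zeta6, DB_j, zeta6 * DB_j, glue v}"
  have one: "s \<in> overorder v" if "s \<in> ?S" for s
    using that by (simp only: overorder_eq_span OK_span_base)
  have e: "zeta6 * zeta6 \<in> eichler_order" "zeta6 * (zeta6 * DB_j) \<in> eichler_order"
    "DB_j * zeta6 \<in> eichler_order" "DB_j * DB_j \<in> eichler_order"
    "DB_j * (zeta6 * DB_j) \<in> eichler_order" "(zeta6 * DB_j) * zeta6 \<in> eichler_order"
    "(zeta6 * DB_j) * DB_j \<in> eichler_order" "(zeta6 * DB_j) * (zeta6 * DB_j) \<in> eichler_order"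
    by (simp_all add: eichler_order_def DB_mult_simps OK_iff zeta6_eq)
  have "zeta6 * glue v - scaleK 2 (glue v) \<in> eichler_order
    \<and> DB_j * glue v - scaleK (- v) (glue v) \<in> eichler_order
    \<and> (zeta6 * DB_j) * glue v - scaleK (- 2 * v) (glue v) \<in> eichler_order
    \<and> glue v * zeta6 - scaleK (- 1) (glue v) \<in> eichler_order
    \<and> glue v * DB_j - scaleK v (glue v) \<in> eichler_order
    \<and> glue v * (zeta6 * DB_j) - scaleK (2 * v) (glue v) \<in> eichler_order
    \<and> glue v * glue v - scaleK 0 (glue v) \<in> eichler_order"
    using v by (elim insertE emptyE)
      (simp_all add: eichler_order_def DB_mult_simps OK_iff zeta6_eq glue_eq)
  moreover have "v \<in> OK" using v by auto
  ultimately have g: "zeta6 * glue v \<in> overorder v" "DB_j * glue v \<in> overorder v"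
    "(zeta6 * DB_j) * glue v \<in> overorder v" "glue v * zeta6 \<in> overorder v"
    "glue v * DB_j \<in> overorder v" "glue v * (zeta6 * DB_j) \<in> overorder v"
    "glue v * glue v \<in> overorder v"
    by (metis overorderI OK_closed(1,2,4,5,8))+
  have "zeta6 * DB_j \<in> ?S" by blast
  with s t show ?thesis
    using one e[THEN subsetD[OF eichler_subset_overorder]] g by (elim insertE emptyE) simp_all
qed

text \<open>In a division algebra regular elements are the nonzero ones, so fractions over a subring remain
  fractions over a larger subring.\<close>

lemma ring_of_fractions_overring:
  assumes Q: "unital_subring Q" and sub: "standard_order \<subseteq> Q"
  shows "ring_of_fractions_is_UNIV Q"
proof -
  have nz: "s \<noteq> 0" if "regular_in P s" "1 \<in> P" for P and s :: DB
    using that by (force simp: regular_in_def)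
  have reg: "regular_in Q s" if "regular_in standard_order s" for s
  proof -
    have "s \<noteq> 0" using nz[OF that] by (simp add: standard_order_iff)
    then obtain t where t: "s * t = 1" "t * s = 1" using DB_invertible by blast
    have "x = t * (s * x)" "x = (x * s) * t" for x
      by (simp_all add: t mult.assoc mult.assoc[symmetric, of t s])
    hence "(s * x = 0 \<longrightarrow> x = 0) \<and> (x * s = 0 \<longrightarrow> x = 0)" for x
      by (metis mult_zero_left mult_zero_right)
    thus ?thesis using that sub unfolding regular_in_def by blast
  qed
  have std: "ring_of_fractions_is_UNIV standard_order"
    using is_order_standard_order by (simp add: is_order_def)
  show ?thesis
    unfolding ring_of_fractions_is_UNIV_def
  proof (intro conjI allI impI)
    fix s assume "regular_in Q s"
    thus "\<exists>t. s * t = 1 \<and> t * s = 1"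
      using nz unital_subring_closed(1)[OF Q] by (intro DB_invertible) blast
  next
    fix x
    obtain a s t where "a \<in> standard_order" "regular_in standard_order s"
        "s * t = 1" "t * s = 1" "x = a * t"
      using std unfolding ring_of_fractions_is_UNIV_def by blast
    thus "\<exists>a s t. a \<in> Q \<and> regular_in Q s \<and> s * t = 1 \<and> t * s = 1 \<and> x = a * t"
      using reg sub by blast
  next
    fix x
    obtain a s t where "a \<in> standard_order" "regular_in standard_order s"
        "s * t = 1" "t * s = 1" "x = t * a"
      using std unfolding ring_of_fractions_is_UNIV_def by blast
    thus "\<exists>a s t. a \<in> Q \<and> regular_in Q s \<and> s * t = 1 \<and> t * s = 1 \<and> x = t * a"
      using reg sub by blast
  qed
qed

lemma is_order_overorder:
  assumes v: "v \<in> {1 - sqrt2, sqrt2 - 1}"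
  shows "is_order (overorder v)"
proof -
  let ?S = "{1, zeta6, DB_j, zeta6 * DB_j, glue v}"
  have "unital_subring (OK_span ?S)"
  proof (rule unital_subring_OK_span)
    fix s t assume "s \<in> ?S" "t \<in> ?S"
    thus "s * t \<in> OK_span ?S"
      using overorder_generators_mult[OF v] by (simp only: overorder_eq_span)
  qed simp
  hence ring: "unital_subring (overorder v)" by (simp only: overorder_eq_span)
  moreover have "standard_order \<subseteq> overorder v"
    using standard_subset_eichler eichler_subset_overorder by blast
  moreover have "finitely_generated_OK_module (overorder v)"
    unfolding finitely_generated_OK_module_def
    by (rule exI[of _ ?S]) (simp add: overorder_eq_span)
  ultimately show ?thesis by (simp add: is_order_def ring_of_fractions_overring)
qed

text \<open>On \<open>overorder (-v)\<close> the functional \<open>2(b + vd)\<close> is integral, since it vanishes on \<open>i(-v + j)/3\<close>; on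
  \<open>i(v + j)/3\<close> it takes the value \<open>4v/3\<close>.\<close>

lemma overorders_incomparable:
  assumes v: "v \<in> {1 - sqrt2, sqrt2 - 1}"
  shows "\<not> overorder v \<subseteq> overorder (- v)"
proof
  assume sub: "overorder v \<subseteq> overorder (- v)"
  have "glue v \<in> overorder v" by (simp only: overorder_eq_span OK_span_base insert_iff simp_thms)
  with sub obtain t where t: "t \<in> OK" "glue v - scaleK t (glue (- v)) \<in> eichler_order"
    by (auto simp: overorder_def)
  define y where "y = glue v - scaleK t (glue (- v))"
  have y: "2 * qi y \<in> OK" "2 * qij y \<in> OK"
    using t(2) by (simp_all only: y_def eichler_order_def mem_Collect_eq)
  have vOK: "v \<in> OK" using v by auto
  \<comment> \<open>The coefficient \<open>t\<close> cancels in this combination.\<close>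
  have "2 * qi y + v * (2 * qij y) = 4 * v / 3"
    by (simp add: y_def glue_def field_simps)
  moreover have "2 * qi y + v * (2 * qij y) \<in> OK" using y vOK by simp
  ultimately have "4 * v / 3 \<in> OK" by (simp only:)
  moreover have "sqrt2_part (4 * v / 3) = 4 / 3 \<or> sqrt2_part (4 * v / 3) = - 4 / 3"
    using v by auto
  moreover have "(4 / 3 :: rat) \<notin> \<int>"
  proof
    assume "(4 / 3 :: rat) \<in> \<int>"
    then obtain k where "(4 / 3 :: rat) = of_int k" by (rule Ints_cases)
    hence "(of_int 4 :: rat) = of_int (3 * k)" by simp
    hence "4 = 3 * k" by (simp only: of_int_eq_iff)
    thus False by presburger
  qed
  ultimately show False by (auto simp: OK_iff)
qed


section \<open>Every order over the standard order lies in one of the two\<close>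

text \<open>Traces against \<open>1, i, j, ij\<close> bound the denominators of the coordinates, which gives
  \<open>(\<surd>2)\<^sup>3 \<cdot> 3x = 6\<surd>2 x \<in> R\<close>; three descents remove the power of \<open>\<surd>2\<close>.\<close>

lemma order_3_multiple_in_eichler:
  assumes M: "is_order M" and sub: "standard_order \<subseteq> M" and x: "x \<in> M"
  shows "scaleK 3 x \<in> eichler_order" "2 * qj x \<in> OK"
proof -
  have ring: "unital_subring M" using M by (simp add: is_order_def)
  have tr: "2 * q1 (x * s) \<in> OK" if "s \<in> standard_order" for s
    using that sub x unital_subring_closed(5)[OF ring] order_trace_OK[OF M] by blast
  have "1 \<in> standard_order" "DB_i \<in> standard_order" "DB_j \<in> standard_order"
    "DB_i * DB_j \<in> standard_order"
    by (simp_all add: standard_order_iff DB_mult_simps)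
  note tr[OF this(1)] tr[OF this(2)] tr[OF this(3)] tr[OF this(4)]
  hence a: "2 * q1 x \<in> OK" and b: "- (6 * qi x) \<in> OK" and c: "2 * (sqrt2 * qj x) \<in> OK"
    and d: "6 * (sqrt2 * qij x) \<in> OK"
    by (simp_all add: DB_mult_simps mult.assoc)
  have "(3 * sqrt2) * (2 * q1 x) \<in> OK" "(- sqrt2) * (- (6 * qi x)) \<in> OK"
    "3 * (2 * (sqrt2 * qj x)) \<in> OK" "6 * (sqrt2 * qij x) \<in> OK"
    by (rule OK_closed(8)[OF _ a], simp, rule OK_closed(8)[OF _ b], simp,
        rule OK_closed(8)[OF _ c], simp, rule d)
  hence "scaleK (6 * sqrt2) x \<in> standard_order" by (simp add: standard_order_iff mult_ac)
  moreover have "scaleK sqrt2 (scaleK sqrt2 (scaleK sqrt2 (scaleK 3 x))) = scaleK (6 * sqrt2) x"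
  proof -
    have "sqrt2 * (sqrt2 * (sqrt2 * 3)) = (sqrt2 * sqrt2) * (3 * sqrt2)" by (simp only: mult_ac)
    thus ?thesis by (simp add: sqrt2_squared)
  qed
  ultimately have E: "scaleK sqrt2 (scaleK sqrt2 (scaleK sqrt2 (scaleK 3 x))) \<in> eichler_order"
    using standard_subset_eichler by (metis subsetD)
  have n: "nrd (scaleK c x) \<in> OK" if "c \<in> OK" for c
    using order_nrd_OK[OF M x] that by (simp add: nrd_scale)
  have "3 \<in> OK" by simp
  hence "nrd (scaleK 3 x) \<in> OK" "nrd (scaleK sqrt2 (scaleK 3 x)) \<in> OK"
    "nrd (scaleK sqrt2 (scaleK sqrt2 (scaleK 3 x))) \<in> OK"
    unfolding DB.scale_scale by (intro n OK_closed)+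
  with E show E3: "scaleK 3 x \<in> eichler_order" by (blast intro: eichler_order_descent)
  hence "3 * qj x - 3 * qij x \<in> OK" "6 * qij x \<in> OK" by (simp_all add: eichler_order_def)
  hence "2 * (3 * qj x - 3 * qij x) + 6 * qij x - sqrt2 * (2 * (sqrt2 * qj x)) \<in> OK"
    using c by (simp only: OK_closed simp_thms)
  moreover have "sqrt2 * (2 * (sqrt2 * qj x)) = 2 * ((sqrt2 * sqrt2) * qj x)"
    by (simp only: mult_ac)
  hence "2 * (3 * qj x - 3 * qij x) + 6 * qij x - sqrt2 * (2 * (sqrt2 * qj x)) = 2 * qj x"
    by (simp add: sqrt2_squared)
  ultimately show "2 * qj x \<in> OK" by (simp only:)
qed

text \<open>Since \<open>3x \<in> R\<close> and twice the coordinates at \<open>1\<close> and \<open>j\<close> are integral, \<open>x\<close> differs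
  from an element of \<open>R\<close> only by thirds in the \<open>i\<close> and \<open>ij\<close>
  directions, and the congruence says that these thirds are proportional to \<open>v : 1\<close>, up to an
  integral error.\<close>

lemma mem_overorder_if_congruent:
  assumes x3: "scaleK 3 x \<in> eichler_order" and a: "2 * q1 x \<in> OK" and c: "2 * qj x \<in> OK"
    and v: "v \<in> OK" and cong: "(6 * qi x - v * (6 * qij x)) / 3 \<in> OK"
  shows "x \<in> overorder v"
proof (rule overorderI)
  define k where "k = (6 * qi x - v * (6 * qij x)) / 3"
  have k: "k \<in> OK" using cong by (simp only: k_def)
  have "3 * (z / 3) = z" for z :: qsqrt2 by simp
  hence "3 * k = 6 * qi x - v * (6 * qij x)" by (simp only: k_def)
  hence bk: "6 * qi x = v * (6 * qij x) + 3 * k" by simp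
  have ab: "3 * q1 x - 3 * qi x \<in> OK" and cd: "3 * qj x - 3 * qij x \<in> OK" and d: "6 * qij x \<in> OK"
    using x3 by (simp_all add: eichler_order_def)
  \<comment> \<open>With this multiple of \<open>i(v + j)/3\<close> the \<open>ij\<close> coordinate \<open>d\<close> becomes \<open>3d\<close>, half of the
    integral element \<open>6d\<close>.\<close>
  show "- (6 * qij x) \<in> OK" using d by simp
  define y where "y = x - scaleK (- (6 * qij x)) (glue v)"
  have coords: "q1 y = q1 x" "qi y = qi x + 2 * v * qij x" "qj y = qj x" "qij y = 3 * qij x"
    by (simp_all add: y_def glue_def)
  have b2: "2 * qi y = v * (6 * qij x) + k"
  proof -
    have "3 * (2 * qi y) = 3 * (v * (6 * qij x) + k)"
      using bk by (simp add: coords algebra_simps)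
    thus ?thesis by (rule mult_left_cancel[THEN iffD1, rotated]) simp
  qed
  \<comment> \<open>The left side is integral after multiplication by \<open>2\<close> and by \<open>3\<close>, hence, as \<open>1 = 3 - 2\<close>, by itself.\<close>
  have eq1: "q1 y - qi y = (3 * q1 x - 3 * qi x) - v * (6 * qij x) - (2 * q1 x - (v * (6 * qij x) + k))"
    unfolding b2[symmetric] by (simp add: coords algebra_simps)
  have eq2: "qj y - qij y = (3 * qj x - 3 * qij x) - 2 * qj x" by (simp add: coords)
  have eq3: "2 * qij y = 6 * qij x" by (simp add: coords)
  show "x - scaleK (- (6 * qij x)) (glue v) \<in> eichler_order"
    unfolding y_def[symmetric] eichler_order_def mem_Collect_eq eq1 eq2 eq3 b2
    by (simp only: ab cd a c d k v OK_closed(6-8) simp_thms)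
qed

lemma order_subset_Un_overorders:
  assumes M: "is_order M" and sub: "standard_order \<subseteq> M"
  shows "M \<subseteq> overorder (1 - sqrt2) \<union> overorder (sqrt2 - 1)"
proof
  fix x assume x: "x \<in> M"
  note E = order_3_multiple_in_eichler[OF M sub x]
  have a: "2 * q1 x \<in> OK" by (rule order_trace_OK[OF M x])
  have bd: "6 * qi x \<in> OK" "6 * qij x \<in> OK" using E(1) by (simp_all add: eichler_order_def)
  define u where "u = 1 - sqrt2"
  have u: "u \<in> OK" by (simp add: u_def)
  have u2: "sqrt2 = u * u - 3 * u" by (simp add: u_def qsqrt2_eq_iff)
  \<comment> \<open>Four times the norm is \<open>(2a)\<^sup>2 - \<surd>2 (2c)\<^sup>2 + ((6b)\<^sup>2 - \<surd>2 (6d)\<^sup>2)/3\<close>, and \<open>\<surd>2\<close> equals \<open>u\<^sup>2 - 3u\<close>.\<close>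
  have nform: "(6 * qi x - u * (6 * qij x)) * (6 * qi x - (- u) * (6 * qij x)) / 3
      = 4 * nrd x - (2 * q1 x) * (2 * q1 x) + sqrt2 * ((2 * qj x) * (2 * qj x))
        - u * ((6 * qij x) * (6 * qij x))"
  proof -
    have "(6 * qi x - u * (6 * qij x)) * (6 * qi x - (- u) * (6 * qij x))
      = 3 * (4 * nrd x - (2 * q1 x) * (2 * q1 x) + sqrt2 * ((2 * qj x) * (2 * qj x))
        - u * ((6 * qij x) * (6 * qij x)))"
      unfolding nrd_def u2 by (simp add: algebra_simps)
    moreover have "3 * z / 3 = z" for z :: qsqrt2 by simp
    ultimately show ?thesis by (simp only:)
  qed
  have "(6 * qi x - u * (6 * qij x)) * (6 * qi x - (- u) * (6 * qij x)) / 3 \<in> OK"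
    unfolding nform by (intro OK_closed order_nrd_OK[OF M x] a E(2) u bd)
  hence "(6 * qi x - u * (6 * qij x)) / 3 \<in> OK \<or> (6 * qi x - (- u) * (6 * qij x)) / 3 \<in> OK"
    by (intro three_prime_OK OK_closed bd u)
  hence "x \<in> overorder u \<or> x \<in> overorder (- u)"
    using mem_overorder_if_congruent[OF E(1) a E(2)] u OK_closed(5)[OF u] by blast
  thus "x \<in> overorder (1 - sqrt2) \<union> overorder (sqrt2 - 1)" by (simp add: u_def)
qed

lemma subgroup_subset_Un:
  fixes M :: "'a::ab_group_add set"
  assumes M: "\<And>x y. x \<in> M \<Longrightarrow> y \<in> M \<Longrightarrow> x + y \<in> M"
    and A: "\<And>x y. x \<in> A \<Longrightarrow> y \<in> A \<Longrightarrow> x - y \<in> A" and B: "\<And>x y. x \<in> B \<Longrightarrow> y \<in> B \<Longrightarrow> x - y \<in> B"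
    and sub: "M \<subseteq> A \<union> B"
  shows "M \<subseteq> A \<or> M \<subseteq> B"
proof (rule ccontr)
  assume "\<not> ?thesis"
  then obtain x y where x: "x \<in> M" "x \<notin> A" and y: "y \<in> M" "y \<notin> B" by blast
  hence "x \<in> B" "y \<in> A" using sub by auto
  moreover have "x + y \<in> A \<or> x + y \<in> B" using M[OF x(1) y(1)] sub by blast
  moreover have "x = (x + y) - y" "y = (x + y) - x" by simp_all
  ultimately show False using A B x(2) y(2) by metis
qed

lemma order_subset_overorder:
  assumes M: "is_order M" and sub: "standard_order \<subseteq> M"
  shows "M \<subseteq> overorder (1 - sqrt2) \<or> M \<subseteq> overorder (sqrt2 - 1)"
proof (rule subgroup_subset_Un)
  have "unital_subring M" using M by (simp add: is_order_def)
  thus "x + y \<in> M" if "x \<in> M" "y \<in> M" for x y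
    using that by (rule unital_subring_closed(4))
  have ring: "unital_subring (overorder v)" if "v \<in> {1 - sqrt2, sqrt2 - 1}" for v
    using is_order_overorder[OF that] by (simp add: is_order_def)
  show "x - y \<in> overorder (1 - sqrt2)"
    if "x \<in> overorder (1 - sqrt2)" "y \<in> overorder (1 - sqrt2)" for x y
    by (rule unital_subring_closed(3)[OF ring that]) simp
  show "x - y \<in> overorder (sqrt2 - 1)"
    if "x \<in> overorder (sqrt2 - 1)" "y \<in> overorder (sqrt2 - 1)" for x y
    by (rule unital_subring_closed(3)[OF ring that]) simp
qed (rule order_subset_Un_overorders[OF M sub])

lemma maximal_order_overorder:
  assumes v: "v \<in> {1 - sqrt2, sqrt2 - 1}"
  shows "is_maximal_order (overorder v)"
  unfolding is_maximal_order_def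
proof (intro conjI allI impI)
  show "is_order (overorder v)" by (rule is_order_overorder[OF v])
  fix M assume M: "is_order M \<and> overorder v \<subseteq> M"
  have "standard_order \<subseteq> M"
    using M standard_subset_eichler eichler_subset_overorder by blast
  hence "M \<subseteq> overorder v \<or> M \<subseteq> overorder (- v)"
    using order_subset_overorder[of M] M v by auto
  thus "M = overorder v" using M overorders_incomparable[OF v] by blast
qed


section \<open>Conjugation by \<open>i\<close>\<close>

lemma conjugate_overorders: "conjugate_orders (overorder v) (overorder (- v))"
proof -
  define i' where "i' = scaleK (- 1 / 3) DB_i"
  have inv: "DB_i * i' = 1" "i' * DB_i = 1"
    by (simp_all add: i'_def DB_eq_iff DB_mult_simps)
  define \<sigma> where "\<sigma> q = DB_i * q * i'" for q
  have \<sigma>: "\<sigma> q = DB (q1 q) (qi q) (- qj q) (- qij q)" for q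
    by (simp add: \<sigma>_def i'_def DB_eq_iff DB_mult_simps)
  have maps: "\<sigma> q \<in> overorder (- w)" if q: "q \<in> overorder w" for q w
  proof -
    obtain t where t: "t \<in> OK" "q - scaleK t (glue w) \<in> eichler_order"
      using q by (auto simp: overorder_def)
    have E: "\<sigma> y \<in> eichler_order" if "y \<in> eichler_order" for y
    proof -
      have "qj y - qij y \<in> OK" "2 * qij y \<in> OK" using that by (simp_all add: eichler_order_def)
      from this[THEN OK_closed(5)] that show ?thesis by (simp add: eichler_order_def \<sigma>)
    qed
    have "\<sigma> q - scaleK (- t) (glue (- w)) = \<sigma> (q - scaleK t (glue w))"
      by (simp add: \<sigma> glue_def DB_eq_iff)
    with E[OF t(2)] t(1) show ?thesis by (intro overorderI[of "- t"]) simp_all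
  qed
  have "overorder (- v) = \<sigma> ` overorder v"
  proof
    show "\<sigma> ` overorder v \<subseteq> overorder (- v)" using maps by blast
    show "overorder (- v) \<subseteq> \<sigma> ` overorder v"
    proof
      fix q assume "q \<in> overorder (- v)"
      hence "\<sigma> q \<in> overorder v" using maps[of q "- v"] by simp
      moreover have "q = \<sigma> (\<sigma> q)" by (simp add: \<sigma> DB_eq_iff)
      ultimately show "q \<in> \<sigma> ` overorder v" by blast
    qed
  qed
  thus ?thesis using inv unfolding conjugate_orders_def \<sigma>_def by blast
qed

theorem lemma1p1:
  shows "\<exists>Q Q'. Q \<noteq> Q' \<and>
           {M. is_maximal_order M \<and> standard_order \<subseteq> M} = {Q, Q'} \<and>
           conjugate_orders Q Q'"
proof (intro exI conjI)
  let ?Q = "overorder (1 - sqrt2)" and ?Q' = "overorder (sqrt2 - 1)"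
  show "?Q \<noteq> ?Q'"
    using overorders_incomparable[of "1 - sqrt2"] by auto
  show "conjugate_orders ?Q ?Q'"
    using conjugate_overorders[of "1 - sqrt2"] by simp
  have max: "is_maximal_order ?Q" "is_maximal_order ?Q'" by (simp_all add: maximal_order_overorder)
  show "{M. is_maximal_order M \<and> standard_order \<subseteq> M} = {?Q, ?Q'}"
  proof
    show "{?Q, ?Q'} \<subseteq> {M. is_maximal_order M \<and> standard_order \<subseteq> M}"
      using max standard_subset_eichler eichler_subset_overorder by blast
    show "{M. is_maximal_order M \<and> standard_order \<subseteq> M} \<subseteq> {?Q, ?Q'}"
    proof
      fix M assume "M \<in> {M. is_maximal_order M \<and> standard_order \<subseteq> M}"
      hence M: "is_maximal_order M" "standard_order \<subseteq> M" by auto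
      hence "M \<subseteq> ?Q \<or> M \<subseteq> ?Q'"
        using order_subset_overorder by (simp add: is_maximal_order_def)
      thus "M \<in> {?Q, ?Q'}" using M(1) max unfolding is_maximal_order_def by blast
    qed
  qed
qed

end
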